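(* Let $B \subset \mathbb{R}^d$ be a compact set, let $C_1 = C_1(B)$ be a constant such that $|f(x)| \leq C_1 |i(x)|$ for all $x \in B$, and let $C_2 := C_1 + \tfrac{1}{5}$. Suppose that $R$, $L$ and $H$ are positive constants such that $\tilde{f} : \mathbb{R}^d \times \mathbb{R}^d \times [0,\infty) \to \mathbb{R}^d$ is an $(R,L,H)$-approximation of $f$ on $B$ and $\tilde{i} : \mathbb{R}^d \times \mathbb{R}^d \times [0,\infty) \to \mathbb{R}^d$ is an $(R,L,H)$-approximation of $i$ on $B$. Define $$R' := \max\{R, 10L\} \quad \text{and} \quad H' := \min\left\{ H, \tfrac{1}{10L}, \tfrac{1}{6 C_2 R'}, \tfrac{1}{(36 C_2 + 6)L} \right\},$$ and suppose that $|f(u) - f(v)| \leq L|u-v|$ for all $u,v \in B_{5R'}(x)$ and all $x \in B$. For each $x \in B$ and $h \in [0,H')$ 1. let $x' \in B_{R'}(x)$ and $\lambda \in \mathbb{R}$ be the unique solution (which exists under these hypotheses) of $x' = x + h \tilde{f}(x,x',h) + \lambda\, \tilde{i}(x,x',h)$ and $I(x') = I(x)$ such that $|\lambda| \leq \tfrac{11}{5} C_2 h$; 2. let $y \in B_{6R'}(x)$ be the unique solution (which exists under these hypotheses) of $y = x + h \tilde{f}(x,y,h)$; and 3. let $x(\cdot)$ denote the exact solution of $\dot{x} = f(x)$ satisfying $x(t) = x$ for some $t \geq 0$. Also suppose that 4. $\tilde{f}$ is such that the method $x \mapsto y$ defined by $y = x + h \tilde{f}(x,y,h)$ is of order $p$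 for some $p \in \mathbb{N}$, i.e. when $f$ is sufficiently smooth there exist positive constants $C_3$ and $H_3 < H'$ such that $$|y - x(t+h)| \leq C_3 h^{p+1} \quad \text{for all } h \in [0,H_3] \text{ and all } x \in B.$$ Then the linear projection method $x \mapsto x'$ defined by $x' = x + h \tilde{f}(x,x',h) + \lambda\, \tilde{i}(x,x',h)$ and $I(x') = I(x)$ is also of order $p$, so that when $f$ is sufficiently smooth there exist positive constants $C_5$ and $H_5$ such that $$|x' - x(t+h)| \leq C_5 h^{p+1} \quad \text{for all } h \in [0,H_5] \text{ and all } x \in B.$$
   Context: Setting: $d \in \mathbb{N}$; $f : \mathbb{R}^d \to \mathbb{R}^d$ is locally Lipschitz continuous; the ODE $\dot{x} = f(x)$ has a first integral $I : \mathbb{R}^d \to \mathbb{R}$ ($I$ is constant along solutions); $I$ is a Morse function (smooth with non-degenerate critical points); $i := \nabla I$ is locally Lipschitz continuous. $|\cdot|$ is the Euclidean norm. For each bounded set $B$ a constant $C_1 = C_1(B)$ with $|f| \le C_1 |i|$ on $B$ exists. For $x \in \mathbb{R}^d$ and $R > 0$, $B_R(x) := \{ z \in \mathbb{R}^d : |z - x| \leq |i(x)|/R \}$ (note the radius $|i(x)|/R$; $B_R(x) = \{x\}$ if $i(x) = 0$). For $\varphi \in \{f, i\}$, a bounded set $B$ and positive constants $R, L, H$, a map $\tilde{\varphi} : \mathbb{R}^d \times \mathbb{R}^d \times [0,\infty) \to \mathbb{R}^d$ is called an $(R,L,H)$-approximation of $\varphi$ on $B$ if for all $x \in B$, all $u,v,w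 \in B_R(x)$ and all $h \in [0,H)$: $\tilde{\varphi}(x,x,0) = \varphi(x)$; $|\tilde{\varphi}(u,v,h) - \tilde{\varphi}(w,v,h)| \leq L|u-w|$; $|\tilde{\varphi}(u,v,h) - \tilde{\varphi}(u,w,h)| \leq L|v-w|$; $|\tilde{\varphi}(x,x,h) - \tilde{\varphi}(x,x,0)| \leq L h |i(x)|$. Order of accuracy: a one-step method $x \mapsto x'$ with time step $h$ for solving $\dot{x} = f(x)$ has order of accuracy $p \in \mathbb{N}$ if for problems with sufficiently smooth $f$ there exist positive constants $C$ and $H$ such that $|x' - x(t+h)| \leq C h^{p+1}$ for all $h \in [0,H]$ and all $x \in B$, where $x(\cdot)$ denotes the solution of $\dot{x} = f(x)$ with $x(t) = x$ for some $t \geq 0$ and $B$ is a compact set in $\mathbb{R}^d$; the constants $C$ and $H$ may depend on $B$ but should be independent of $x$ and $h$.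
   Formalization: The unique solution (x', λ) need not exist for all h in [0,H') under the stated hypotheses: x' can be non-unique, and so can λ where i(x)=0. Unique existence of x' is instead concluded for h in [0,H_5], with H_5<H', and the error bound holds for every admissible x'. *)

theory Defs
  imports "HOL-Analysis.Analysis"
begin

text \<open>\<open>C_k k g\<close>: \<open>g\<close> is \<open>k\<close> times continuously differentiable on the whole space.\<close>

fun C_k :: "nat \<Rightarrow> ('a::euclidean_space \<Rightarrow> 'b::euclidean_space) \<Rightarrow> bool" where
  "C_k 0 g \<longleftrightarrow> continuous_on UNIV g"
| "C_k (Suc k) g \<longleftrightarrow>
     g differentiable_on UNIV \<and> (\<forall>v. C_k k (\<lambda>x. frechet_derivative g (at x) v))"

definition smooth :: "('a::euclidean_space \<Rightarrow> 'b::euclidean_space) \<Rightarrow> bool" where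
  "smooth g \<longleftrightarrow> (\<forall>k. C_k k g)"

definition grad :: "(real^'n \<Rightarrow> real) \<Rightarrow> real^'n \<Rightarrow> real^'n" where
  "grad I x = (\<chi> j. frechet_derivative I (at x) (axis j 1))"

text \<open>The Jacobian matrix of the gradient is the Hessian matrix.\<close>

definition morse_function :: "(real^'n \<Rightarrow> real) \<Rightarrow> bool" where
  "morse_function I \<longleftrightarrow>
     smooth I \<and> (\<forall>x. grad I x = 0 \<longrightarrow> det (jacobian (grad I) (at x)) \<noteq> 0)"

text \<open>Local solutions are allowed, since no global existence is available for a locally
  Lipschitz vector field.\<close>

definition ode_solution_on ::
    "(real^'n \<Rightarrow> real^'n) \<Rightarrow> real set \<Rightarrow> (real \<Rightarrow> real^'n) \<Rightarrow> bool" where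
  "ode_solution_on f T X \<longleftrightarrow>
     (\<forall>s\<in>T. (X has_vector_derivative f (X s)) (at s within T))"

definition first_integral :: "(real^'n \<Rightarrow> real^'n) \<Rightarrow> (real^'n \<Rightarrow> real) \<Rightarrow> bool" where
  "first_integral f I \<longleftrightarrow>
     (\<forall>T X. is_interval T \<and> ode_solution_on f T X \<longrightarrow> (\<lambda>s. I (X s)) constant_on T)"

definition iball :: "(real^'n \<Rightarrow> real^'n) \<Rightarrow> real \<Rightarrow> real^'n \<Rightarrow> (real^'n) set" where
  "iball i R x = {z. norm (z - x) \<le> norm (i x) / R}"

text \<open>A map on \<open>\<real>\<^sup>d \<times> \<real>\<^sup>d \<times> [0,\<infinity>)\<close> is a curried function whose values at negative
  step sizes are irrelevant.\<close>

definition approximation ::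
    "(real^'n \<Rightarrow> real^'n) \<Rightarrow> real \<Rightarrow> real \<Rightarrow> real \<Rightarrow> (real^'n) set \<Rightarrow> (real^'n \<Rightarrow> real^'n) \<Rightarrow>
     (real^'n \<Rightarrow> real^'n \<Rightarrow> real \<Rightarrow> real^'n) \<Rightarrow> bool" where
  "approximation i R L H B \<phi> \<phi>t \<longleftrightarrow>
     (\<forall>x\<in>B. \<forall>u\<in>iball i R x. \<forall>v\<in>iball i R x. \<forall>w\<in>iball i R x. \<forall>h\<in>{0..<H}.
        \<phi>t x x 0 = \<phi> x \<and>
        norm (\<phi>t u v h - \<phi>t w v h) \<le> L * norm (u - w) \<and>
        norm (\<phi>t u v h - \<phi>t u w h) \<le> L * norm (v - w) \<and>
        norm (\<phi>t x x h - \<phi>t x x 0) \<le> L * h * norm (i x))"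

text \<open>One-step methods are given by relations \<open>M h x x'\<close> (``\<open>x'\<close> is a step of size \<open>h\<close> from
  \<open>x\<close>''), because the methods of interest are implicit.\<close>

definition implicit_step ::
    "(real^'n \<Rightarrow> real^'n) \<Rightarrow> real \<Rightarrow> (real^'n \<Rightarrow> real^'n \<Rightarrow> real \<Rightarrow> real^'n) \<Rightarrow>
     real \<Rightarrow> real^'n \<Rightarrow> real^'n \<Rightarrow> bool" where
  "implicit_step i R ft h x y \<longleftrightarrow> y \<in> iball i R x \<and> y = x + h *\<^sub>R ft x y h"

text \<open>The multiplier \<open>\<mu>\<close> is determined by \<open>x'\<close> only if \<open>it x x' h \<noteq> 0\<close>; at a critical point of
  \<open>I\<close> every \<open>\<mu>\<close> solves the equations with \<open>x' = x\<close>.\<close>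

definition projection_step ::
    "(real^'n \<Rightarrow> real) \<Rightarrow> (real^'n \<Rightarrow> real^'n) \<Rightarrow> real \<Rightarrow> real \<Rightarrow>
     (real^'n \<Rightarrow> real^'n \<Rightarrow> real \<Rightarrow> real^'n) \<Rightarrow> (real^'n \<Rightarrow> real^'n \<Rightarrow> real \<Rightarrow> real^'n) \<Rightarrow>
     real \<Rightarrow> real^'n \<Rightarrow> real^'n \<Rightarrow> bool" where
  "projection_step I i R c ft it h x x' \<longleftrightarrow>
     x' \<in> iball i R x \<and>
     (\<exists>\<mu>. \<bar>\<mu>\<bar> \<le> c * h \<and> x' = x + h *\<^sub>R ft x x' h + \<mu> *\<^sub>R it x x' h \<and> I x' = I x)"

text \<open>Order \<open>p\<close> on \<open>B\<close>, for a method considered for step sizes in \<open>[0,Hmax)\<close>: for small step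
  sizes each step is uniquely defined, and its error against every exact solution through
  \<open>x\<close> is at most \<open>C * h ^ (p + 1)\<close>.\<close>

definition has_order ::
    "(real^'n \<Rightarrow> real^'n) \<Rightarrow> (real^'n) set \<Rightarrow> real \<Rightarrow>
     (real \<Rightarrow> real^'n \<Rightarrow> real^'n \<Rightarrow> bool) \<Rightarrow> nat \<Rightarrow> bool" where
  "has_order f B Hmax M p \<longleftrightarrow>
     (\<exists>C>0. \<exists>H>0. H < Hmax \<and>
        (\<forall>h\<in>{0..H}. \<forall>x\<in>B.
           (\<exists>!x'. M h x x') \<and>
           (\<forall>x' X t. M h x x' \<and> 0 \<le> t \<and> ode_solution_on f {t..t + h} X \<and> X t = x \<longrightarrow>
              norm (x' - X (t + h)) \<le> C * h ^ (p + 1))))"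

end

theory Submission
  imports Defs
begin

text \<open>For small \<open>h\<close> every point in play lies within \<open>O(h |\<nabla>I(x)|)\<close> of \<open>x\<close>, where \<open>I\<close> is linear up to a small
  relative error.  The step equation with fixed multiplier \<open>\<mu>\<close> is a contraction, and \<open>I\<close> minus \<open>I(x)\<close> at its
  fixed point changes sign as \<open>\<mu>\<close> runs over the admissible interval.  Two such fixed points \<open>u\<close>, \<open>v\<close> differ
  by a vector nearly parallel to \<open>\<nabla>I(x)\<close>, so \<open>|\<nabla>I(x)| |u - v| \<le> 4 |I(u) - I(v)|\<close>.  This gives
  uniqueness; applied to \<open>x'\<close> and \<open>y\<close> (multiplier \<open>0\<close>) it gives the order, because the exact solution \<open>z\<close>
  satisfies \<open>I(z) = I(x) = I(x')\<close>, so that \<open>|I(x') - I(y)| = |I(z) - I(y)|\<close> is of size \<open>|\<nabla>I(x)| |z - y|\<close>.\<close>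

section \<open>The projected step: solvability, uniqueness and error\<close>

text \<open>Meant for \<open>d\<close> the difference of two fixed points, \<open>g\<close> a value
  of \<open>G\<close> and \<open>\<eta>\<close> the increment of \<open>I\<close>. Absorbing
  \<open>e\<close> gives |d| \<le> 36/25 |\<delta>| |a|, hence |\<delta> (a . g)| \<ge> 5/9 |a| |d|.
  Subtracting 1/6 for \<open>e\<close> and 1/10 for the linearization error leaves 13/45, which
  exceeds 1/4.\<close>

lemma norm_le_increment:
  fixes a d e g :: "'a::real_inner"
  assumes d: "d = e + \<delta> *\<^sub>R g" and e: "norm e \<le> norm d / 6"
    and g: "norm g \<le> 6 / 5 * norm a" and ag: "4 / 5 * (norm a)\<^sup>2 \<le> a \<bullet> g"
    and \<eta>: "\<bar>\<eta> - a \<bullet> d\<bar> \<le> norm a / 10 * norm d"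
  shows "norm a * norm d \<le> 4 * \<bar>\<eta>\<bar>"
proof -
  have "norm d \<le> norm e + \<bar>\<delta>\<bar> * norm g"
    unfolding d by (metis norm_scaleR norm_triangle_ineq)
  also have "\<bar>\<delta>\<bar> * norm g \<le> \<bar>\<delta>\<bar> * (6 / 5 * norm a)"
    by (rule mult_left_mono[OF g]) simp
  finally have "norm d \<le> 36 / 25 * (\<bar>\<delta>\<bar> * norm a)"
    using e by simp
  then have "norm a * norm d \<le> norm a * (36 / 25 * (\<bar>\<delta>\<bar> * norm a))"
    by (rule mult_left_mono) simp
  then have 1: "norm a * norm d \<le> 36 / 25 * (\<bar>\<delta>\<bar> * (norm a)\<^sup>2)"
    by (simp add: power2_eq_square mult_ac)
  have "4 / 5 * (\<bar>\<delta>\<bar> * (norm a)\<^sup>2) \<le> \<bar>\<delta>\<bar> * (a \<bullet> g)"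
    using mult_left_mono[OF ag, of "\<bar>\<delta>\<bar>"] by (simp add: mult_ac)
  also have "\<dots> \<le> \<bar>\<delta> * (a \<bullet> g)\<bar>"
    by (simp add: abs_mult mult_left_mono)
  finally have 2: "4 / 5 * (\<bar>\<delta>\<bar> * (norm a)\<^sup>2) \<le> \<bar>\<delta> * (a \<bullet> g)\<bar>" .
  have "\<bar>a \<bullet> e\<bar> \<le> norm a * norm e"
    by (rule Cauchy_Schwarz_ineq2)
  also have "\<dots> \<le> norm a * (norm d / 6)"
    by (rule mult_left_mono[OF e]) simp
  finally have 3: "\<bar>a \<bullet> e\<bar> \<le> norm a * norm d / 6" by simp
  have 4: "a \<bullet> d = a \<bullet> e + \<delta> * (a \<bullet> g)"
    unfolding d by (simp add: inner_add_right)
  have 5: "\<bar>\<eta> - a \<bullet> d\<bar> \<le> norm a * norm d / 10"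
    using \<eta> by simp
  show ?thesis using 1 2 3 4 5 by linarith
qed

text \<open>A single step of size \<open>h\<close> from \<open>x\<close>: \<open>a\<close> is the gradient of \<open>I\<close> at \<open>x\<close>, and \<open>F u\<close>, \<open>G u\<close> stand for
  the approximations of \<open>f\<close>, \<open>\<nabla>I\<close> evaluated at \<open>(x, u, h)\<close>.\<close>

locale projected_step =
  fixes x a :: "'a::euclidean_space" and F G :: "'a \<Rightarrow> 'a" and I :: "'a \<Rightarrow> real"
    and r L C h :: real
  assumes nonneg: "0 \<le> h" "0 \<le> C" "0 \<le> L"
    and lip_F: "\<lbrakk>u \<in> cball x r; v \<in> cball x r\<rbrakk> \<Longrightarrow> norm (F u - F v) \<le> L * norm (u - v)"
    and lip_G: "\<lbrakk>u \<in> cball x r; v \<in> cball x r\<rbrakk> \<Longrightarrow> norm (G u - G v) \<le> L * norm (u - v)"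
    and bound_F: "u \<in> cball x r \<Longrightarrow> norm (F u) \<le> C * norm a"
    and approx_G: "u \<in> cball x r \<Longrightarrow> norm (G u - a) \<le> norm a / 5"
    and small: "h * L * (1 + 11 / 5 * C) \<le> 1 / 6" "6 * h * C * norm a \<le> r"
    and linearization: "\<lbrakk>u \<in> cball x (4 * h * C * norm a); v \<in> cball x (4 * h * C * norm a)\<rbrakk> \<Longrightarrow>
      \<bar>I u - I v - a \<bullet> (u - v)\<bar> \<le> norm a / 10 * norm (u - v)"
begin

lemma norm_G_le: "u \<in> cball x r \<Longrightarrow> norm (G u) \<le> 6 / 5 * norm a"
  using approx_G[of u] norm_triangle_ineq2[of "G u" a] by simp

lemma inner_G_ge:
  assumes "u \<in> cball x r"
  shows "4 / 5 * (norm a)\<^sup>2 \<le> a \<bullet> G u"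
proof -
  have "\<bar>a \<bullet> (G u - a)\<bar> \<le> norm a * norm (G u - a)"
    by (rule Cauchy_Schwarz_ineq2)
  also have "\<dots> \<le> norm a * (norm a / 5)"
    by (rule mult_left_mono[OF approx_G[OF assms]]) simp
  finally have "\<bar>a \<bullet> G u - (norm a)\<^sup>2\<bar> \<le> (norm a)\<^sup>2 / 5"
    by (simp add: inner_diff_right power2_norm_eq_inner power2_eq_square[of "norm a", symmetric])
  then show ?thesis by linarith
qed

definition step_map :: "real \<Rightarrow> 'a \<Rightarrow> 'a" where
  "step_map \<mu> u = x + h *\<^sub>R F u + \<mu> *\<^sub>R G u"

text \<open>In units of \<open>h * C * norm a\<close>, the drift contributes 1 and the multiplier
  term 11/5 * 6/5, in all 91/25 < 4. The target is the inner ball, so every fixed point lies where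
  \<open>linearization\<close> is available.\<close>

lemma step_map_mem:
  assumes "u \<in> cball x r" and "\<bar>\<mu>\<bar> \<le> 11 / 5 * C * h"
  shows "step_map \<mu> u \<in> cball x (4 * h * C * norm a)"
proof -
  have "norm (step_map \<mu> u - x) \<le> norm (h *\<^sub>R F u) + norm (\<mu> *\<^sub>R G u)"
    using norm_triangle_ineq[of "h *\<^sub>R F u" "\<mu> *\<^sub>R G u"] by (simp add: step_map_def)
  also have "norm (h *\<^sub>R F u) \<le> h * (C * norm a)"
    using bound_F[OF assms(1)] nonneg by (simp add: mult_left_mono)
  also have "norm (\<mu> *\<^sub>R G u) \<le> 11 / 5 * C * h * (6 / 5 * norm a)"
    unfolding norm_scaleR by (rule mult_mono[OF assms(2) norm_G_le[OF assms(1)]]) (use nonneg in auto)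
  finally have "norm (step_map \<mu> u - x) \<le> 91 / 25 * (h * C * norm a)"
    by (simp add: algebra_simps)
  moreover have "0 \<le> h * C * norm a"
    using nonneg by simp
  ultimately show ?thesis
    by (simp add: dist_norm norm_minus_commute)
qed

lemma small_ball: "cball x (4 * h * C * norm a) \<subseteq> cball x r"
proof -
  have "0 \<le> h * C * norm a" using nonneg by simp
  then show ?thesis using small(2) by (intro cball_subset_cball_iff[THEN iffD2]) auto
qed

text \<open>Changing the argument costs a small error \<open>e\<close>; changing the multiplier is
  an exact shift along \<open>G v\<close>. With equal multipliers this is the contraction estimate,
  and at fixed points it is the decomposition required by \<open>norm_le_increment\<close>.\<close>

lemma step_map_diff:
  assumes u: "u \<in> cball x r" and v: "v \<in> cball x r" and \<mu>: "\<bar>\<mu>\<bar> \<le> 11 / 5 * C * h"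
  obtains e where "step_map \<mu> u - step_map \<nu> v = e + (\<mu> - \<nu>) *\<^sub>R G v" "norm e \<le> norm (u - v) / 6"
proof
  let ?e = "h *\<^sub>R (F u - F v) + \<mu> *\<^sub>R (G u - G v)"
  show "step_map \<mu> u - step_map \<nu> v = ?e + (\<mu> - \<nu>) *\<^sub>R G v"
    by (simp add: step_map_def algebra_simps)
  have "norm ?e \<le> norm (h *\<^sub>R (F u - F v)) + norm (\<mu> *\<^sub>R (G u - G v))"
    by (rule norm_triangle_ineq)
  also have "norm (h *\<^sub>R (F u - F v)) \<le> h * (L * norm (u - v))"
    using lip_F[OF u v] nonneg by (simp add: mult_left_mono)
  also have "norm (\<mu> *\<^sub>R (G u - G v)) \<le> 11 / 5 * C * h * (L * norm (u - v))"
    unfolding norm_scaleR by (rule mult_mono[OF \<mu> lip_G[OF u v]]) (use nonneg in auto)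
  finally have "norm ?e \<le> h * L * (1 + 11 / 5 * C) * norm (u - v)"
    by (simp add: algebra_simps)
  also have "\<dots> \<le> 1 / 6 * norm (u - v)"
    by (rule mult_right_mono[OF small(1)]) simp
  finally show "norm ?e \<le> norm (u - v) / 6" by simp
qed

lemma ex_fixpoint:
  assumes \<mu>: "\<bar>\<mu>\<bar> \<le> 11 / 5 * C * h"
  shows "\<exists>u\<in>cball x r. step_map \<mu> u = u"
proof -
  have "0 \<le> 6 * h * C * norm a" using nonneg by simp
  then have "0 \<le> r" using small(2) by linarith
  have "\<exists>!u. u \<in> cball x r \<and> step_map \<mu> u = u"
  proof (rule Banach_fix[where c = "1 / 6"])
    show "complete (cball x r)" by (simp add: complete_eq_closed)
    show "cball x r \<noteq> {}" using \<open>0 \<le> r\<close> by simp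
    show "step_map \<mu> ` cball x r \<subseteq> cball x r"
      using step_map_mem[OF _ \<mu>] small_ball by blast
    show "dist (step_map \<mu> u) (step_map \<mu> v) \<le> 1 / 6 * dist u v"
      if uv: "u \<in> cball x r" "v \<in> cball x r" for u v
      using step_map_diff[OF uv \<mu>, of \<mu>] by (auto simp: dist_norm)
  qed auto
  then show ?thesis by blast
qed

lemma fixpoint_increment:
  assumes u: "u \<in> cball x r" and v: "v \<in> cball x r"
    and \<mu>: "\<bar>\<mu>\<bar> \<le> 11 / 5 * C * h" and \<nu>: "\<bar>\<nu>\<bar> \<le> 11 / 5 * C * h"
    and fix_u: "step_map \<mu> u = u" and fix_v: "step_map \<nu> v = v"
  shows "norm a * norm (u - v) \<le> 4 * \<bar>I u - I v\<bar>"
proof -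
  obtain e where "u - v = e + (\<mu> - \<nu>) *\<^sub>R G v" "norm e \<le> norm (u - v) / 6"
    using step_map_diff[OF u v \<mu>, of \<nu>] fix_u fix_v by metis
  then show ?thesis
    using norm_G_le[OF v] inner_G_ge[OF v]
  proof (rule norm_le_increment)
    show "\<bar>(I u - I v) - a \<bullet> (u - v)\<bar> \<le> norm a / 10 * norm (u - v)"
      using step_map_mem[OF u \<mu>] step_map_mem[OF v \<nu>] fix_u fix_v
      by (intro linearization) auto
  qed
qed

lemma abs_increment_le:
  assumes "u \<in> cball x (4 * h * C * norm a)" "v \<in> cball x (4 * h * C * norm a)"
  shows "\<bar>I u - I v\<bar> \<le> 11 / 10 * norm a * norm (u - v)"
proof -
  have "\<bar>I u - I v\<bar> \<le> norm a / 10 * norm (u - v) + norm a * norm (u - v)"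
    using linearization[OF assms] Cauchy_Schwarz_ineq2[of a "u - v"] by linarith
  then show ?thesis by (simp add: algebra_simps)
qed

text \<open>With q = h C |a|^2, the multiplier term contributes at least 11/5 * 4/5 = 44/25 of q,
  whereas the drift and the linearization error together take at most 1 + 2/5 = 35/25. The extreme
  multiplier therefore decides the sign; \<open>sgn\<close> covers both endpoints at once.\<close>

lemma increment_from_start:
  assumes u: "u \<in> cball x r" and fix_u: "step_map \<mu> u = u" and \<mu>: "\<bar>\<mu>\<bar> = 11 / 5 * C * h"
  shows "0 \<le> sgn \<mu> * (I u - I x)"
proof -
  let ?q = "h * C * (norm a)\<^sup>2"
  have mem: "u \<in> cball x (4 * h * C * norm a)"
    using step_map_mem[OF u eq_refl[OF \<mu>]] fix_u by simp
  have "x \<in> cball x (4 * h * C * norm a)" using nonneg by simp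
  then have "\<bar>I u - I x - a \<bullet> (u - x)\<bar> \<le> norm a / 10 * norm (u - x)"
    by (rule linearization[OF mem])
  also have "\<dots> \<le> norm a / 10 * (4 * h * C * norm a)"
    by (rule mult_left_mono) (use mem in \<open>auto simp: dist_norm norm_minus_commute\<close>)
  finally have 1: "\<bar>I u - I x - a \<bullet> (u - x)\<bar> \<le> 2 / 5 * ?q"
    by (simp add: power2_eq_square algebra_simps)
  have "\<bar>a \<bullet> F u\<bar> \<le> norm a * norm (F u)"
    by (rule Cauchy_Schwarz_ineq2)
  also have "\<dots> \<le> norm a * (C * norm a)"
    by (rule mult_left_mono[OF bound_F[OF u]]) simp
  finally have "h * \<bar>a \<bullet> F u\<bar> \<le> h * (norm a * (C * norm a))"
    using nonneg(1) by (rule mult_left_mono)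
  then have 2: "\<bar>h * (a \<bullet> F u)\<bar> \<le> ?q"
    using nonneg by (simp add: abs_mult power2_eq_square algebra_simps)
  have "u - x = h *\<^sub>R F u + \<mu> *\<^sub>R G u"
    using arg_cong[OF fix_u, of "\<lambda>w. w - x"] by (simp add: step_map_def)
  then have 3: "a \<bullet> (u - x) = h * (a \<bullet> F u) + \<mu> * (a \<bullet> G u)"
    by (simp add: inner_add_right)
  have "\<bar>\<mu>\<bar> * (4 / 5 * (norm a)\<^sup>2) \<le> \<bar>\<mu>\<bar> * (a \<bullet> G u)"
    by (rule mult_left_mono[OF inner_G_ge[OF u]]) simp
  then have 4: "44 / 25 * ?q \<le> \<bar>\<mu>\<bar> * (a \<bullet> G u)"
    unfolding \<mu> by (simp add: algebra_simps)
  have 5: "0 \<le> ?q" using nonneg by simp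
  show ?thesis
  proof (cases \<mu> "0::real" rule: linorder_cases)
    case less
    then have "44 / 25 * ?q \<le> - (\<mu> * (a \<bullet> G u))" using 4 by simp
    then have "I u - I x \<le> 0" using 1 2 5 unfolding 3 abs_le_iff by linarith
    then show ?thesis using less by simp
  next
    case greater
    then have "44 / 25 * ?q \<le> \<mu> * (a \<bullet> G u)" using 4 by simp
    then have "0 \<le> I u - I x" using 1 2 5 unfolding 3 abs_le_iff by linarith
    then show ?thesis using greater by simp
  qed simp
qed

lemma ex_projection:
  "\<exists>u\<in>cball x r. \<exists>\<mu>. \<bar>\<mu>\<bar> \<le> 11 / 5 * C * h \<and> step_map \<mu> u = u \<and> I u = I x"
proof -
  let ?\<Lambda> = "11 / 5 * C * h"
  have \<Lambda>: "0 \<le> ?\<Lambda>" using nonneg by simp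
  have "\<forall>\<mu>\<in>{-?\<Lambda>..?\<Lambda>}. \<exists>u. u \<in> cball x r \<and> step_map \<mu> u = u"
    using ex_fixpoint by (metis abs_le_iff atLeastAtMost_iff minus_le_iff)
  then obtain U where "\<forall>\<mu>\<in>{-?\<Lambda>..?\<Lambda>}. U \<mu> \<in> cball x r \<and> step_map \<mu> (U \<mu>) = U \<mu>"
    by metis
  then have U: "U \<mu> \<in> cball x r" "step_map \<mu> (U \<mu>) = U \<mu>" if "\<bar>\<mu>\<bar> \<le> ?\<Lambda>" for \<mu>
    using that by (simp_all only: abs_le_iff atLeastAtMost_iff minus_le_iff Ball_def)
  \<comment> \<open>The \<open>e\<close> part absorbs one sixth of the left side, and 6/5 * 6/5 =
    36/25. This Lipschitz bound makes \<open>I\<close> continuous along the curve of fixed points,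
    as the intermediate value theorem requires.\<close>
  have U_lip: "norm (U \<mu> - U \<nu>) \<le> 36 / 25 * norm a * \<bar>\<mu> - \<nu>\<bar>"
    if \<mu>: "\<bar>\<mu>\<bar> \<le> ?\<Lambda>" and \<nu>: "\<bar>\<nu>\<bar> \<le> ?\<Lambda>" for \<mu> \<nu>
  proof -
    obtain e where e: "U \<mu> - U \<nu> = e + (\<mu> - \<nu>) *\<^sub>R G (U \<nu>)" "norm e \<le> norm (U \<mu> - U \<nu>) / 6"
      using step_map_diff[OF U(1)[OF \<mu>] U(1)[OF \<nu>] \<mu>, of \<nu>] U(2)[OF \<mu>] U(2)[OF \<nu>] by metis
    have "norm (U \<mu> - U \<nu>) \<le> norm e + \<bar>\<mu> - \<nu>\<bar> * norm (G (U \<nu>))"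
      unfolding e(1) by (metis norm_scaleR norm_triangle_ineq)
    also have "\<bar>\<mu> - \<nu>\<bar> * norm (G (U \<nu>)) \<le> \<bar>\<mu> - \<nu>\<bar> * (6 / 5 * norm a)"
      by (rule mult_left_mono[OF norm_G_le[OF U(1)[OF \<nu>]]]) simp
    finally show ?thesis using e(2) by (simp add: algebra_simps)
  qed
  have "continuous_on {-?\<Lambda>..?\<Lambda>} (\<lambda>\<mu>. I (U \<mu>))"
  proof (rule lipschitz_on_continuous_on[OF lipschitz_onI])
    fix \<mu> \<nu> assume "\<mu> \<in> {-?\<Lambda>..?\<Lambda>}" "\<nu> \<in> {-?\<Lambda>..?\<Lambda>}"
    then have \<mu>: "\<bar>\<mu>\<bar> \<le> ?\<Lambda>" and \<nu>: "\<bar>\<nu>\<bar> \<le> ?\<Lambda>" by (auto simp: abs_le_iff)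
    have "\<bar>I (U \<mu>) - I (U \<nu>)\<bar> \<le> 11 / 10 * norm a * norm (U \<mu> - U \<nu>)"
      using step_map_mem[OF U(1)[OF \<mu>] \<mu>] step_map_mem[OF U(1)[OF \<nu>] \<nu>] U(2)[OF \<mu>] U(2)[OF \<nu>]
      by (intro abs_increment_le) auto
    also have "\<dots> \<le> 11 / 10 * norm a * (36 / 25 * norm a * \<bar>\<mu> - \<nu>\<bar>)"
      by (rule mult_left_mono[OF U_lip[OF \<mu> \<nu>]]) simp
    finally show "dist (I (U \<mu>)) (I (U \<nu>)) \<le> (11 / 10 * norm a * (36 / 25 * norm a)) * dist \<mu> \<nu>"
      by (simp add: dist_real_def mult_ac)
  qed simp
  moreover have "I (U (-?\<Lambda>)) \<le> I x \<and> I x \<le> I (U ?\<Lambda>)" if "0 < ?\<Lambda>"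
  proof -
    have "\<bar>-?\<Lambda>\<bar> \<le> ?\<Lambda>" "\<bar>?\<Lambda>\<bar> \<le> ?\<Lambda>" "\<bar>-?\<Lambda>\<bar> = ?\<Lambda>" "\<bar>?\<Lambda>\<bar> = ?\<Lambda>" "sgn (-?\<Lambda>) = -1" "sgn ?\<Lambda> = 1"
      using \<Lambda> that by (simp_all only: abs_of_nonneg abs_minus_cancel sgn_minus sgn_pos order_refl)
    then show ?thesis
      using increment_from_start[of "U (-?\<Lambda>)" "-?\<Lambda>"] increment_from_start[of "U ?\<Lambda>" "?\<Lambda>"]
        U[of "-?\<Lambda>"] U[of "?\<Lambda>"] by simp
  qed
  \<comment> \<open>For a degenerate interval \<open>increment_from_start\<close> says nothing, as
    \<open>sgn 0 = 0\<close>. Instead \<open>h * C = 0\<close> shrinks the inner ball to a point and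
    forces \<open>U 0 = x\<close>.\<close>
  moreover have "I (U 0) = I x" if "?\<Lambda> = 0"
  proof -
    have "U 0 = step_map 0 (U 0)" "U 0 \<in> cball x r" using U[of 0] that by auto
    then have "U 0 \<in> cball x (4 * h * C * norm a)"
      using step_map_mem[of "U 0" 0] that by simp
    then show ?thesis using that by auto
  qed
  ultimately have "\<exists>\<mu>. -?\<Lambda> \<le> \<mu> \<and> \<mu> \<le> ?\<Lambda> \<and> I (U \<mu>) = I x"
    using \<Lambda> IVT'[of "\<lambda>\<mu>. I (U \<mu>)" "-?\<Lambda>" "I x" "?\<Lambda>"]
    by (cases "?\<Lambda> = 0") (force, simp)
  then show ?thesis using U by (metis abs_le_iff minus_le_iff)
qed

text \<open>Triangle inequality through the unprojected step \<open>v\<close>: |u - v| is at most 4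
  * 11/10 = 22/5 times |v - z|, since \<open>I z = I u\<close>, and 22/5 + 1 < 6. Cancelling
  \<open>norm a\<close> is where \<open>a \<noteq> 0\<close> enters.\<close>

lemma projection_error:
  assumes a: "a \<noteq> 0"
    and u: "u \<in> cball x r" "\<bar>\<mu>\<bar> \<le> 11 / 5 * C * h" "step_map \<mu> u = u"
    and v: "v \<in> cball x r" "step_map 0 v = v"
    and z: "z \<in> cball x (4 * h * C * norm a)" "I z = I u"
  shows "norm (u - z) \<le> 6 * norm (v - z)"
proof -
  have 0: "\<bar>0::real\<bar> \<le> 11 / 5 * C * h" using nonneg by simp
  have v': "v \<in> cball x (4 * h * C * norm a)"
    using step_map_mem[OF v(1) 0] v(2) by simp
  have "norm a * norm (u - v) \<le> 4 * \<bar>I u - I v\<bar>"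
    by (rule fixpoint_increment[OF u(1) v(1) u(2) 0 u(3) v(2)])
  also have "\<dots> \<le> 4 * (11 / 10 * norm a * norm (v - z))"
    using abs_increment_le[OF v' z(1)] z(2) by (simp add: abs_minus_commute)
  finally have "norm a * norm (u - v) \<le> norm a * (22 / 5 * norm (v - z))"
    by (simp add: algebra_simps)
  then have "norm (u - v) \<le> 22 / 5 * norm (v - z)"
    using a by simp
  then show ?thesis
    using norm_triangle_ineq[of "u - v" "v - z"] norm_ge_zero[of "v - z"]
    by (simp del: norm_ge_zero)
qed

end

section \<open>A priori bound for exact solutions\<close>

text \<open>A first-exit argument: the bound on \<open>f\<close> holds only inside the ball, but a
  solution of speed at most \<open>M\<close> covers less than \<open>\<rho>\<close> in time
  \<open>h\<close> and so cannot reach the boundary.\<close>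

lemma solution_stays_close:
  fixes X :: "real \<Rightarrow> real^'n"
  assumes X: "ode_solution_on f {t..t + h} X" and h: "0 \<le> h" and t: "X t = x"
    and bound: "\<And>z. z \<in> cball x \<rho> \<Longrightarrow> norm (f z) \<le> M"
    and M: "M * h < \<rho>" and M0: "0 \<le> M"
  shows "norm (X (t + h) - x) \<le> M * h"
proof -
  have cont: "continuous_on {t..t + h} X"
    using X unfolding ode_solution_on_def
    by (metis continuous_on_eq_continuous_within has_vector_derivative_continuous)
  \<comment> \<open>Only times strictly before \<open>s\<close> must be inside, so that the estimate
    still applies at the exit time itself.\<close>
  have *: "norm (X s - x) \<le> M * (s - t)"
    if s: "s \<in> {t..t + h}" and inside: "\<And>w. t < w \<Longrightarrow> w < s \<Longrightarrow> X w \<in> cball x \<rho>" for s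
  proof (cases "t < s")
    case True
    have "norm (X s - X t) \<le> M * s - M * t"
    proof (rule differentiable_bound_general[OF True, where f' = "\<lambda>w. f (X w)" and \<phi>' = "\<lambda>_. M"])
      show "continuous_on {t..s} X" by (rule continuous_on_subset[OF cont]) (use s in auto)
      show "continuous_on {t..s} ((*) M)" by (intro continuous_intros)
      fix w assume w: "t < w" "w < s"
      then have "(X has_vector_derivative f (X w)) (at w within {t..t + h})"
        using X s by (auto simp: ode_solution_on_def)
      then show "(X has_vector_derivative f (X w)) (at w)"
        using w s at_within_Icc_at[of t w "t + h"] by simp
      show "((*) M has_vector_derivative M) (at w)"
        by (auto intro!: derivative_eq_intros)
      show "norm (f (X w)) \<le> M" by (rule bound[OF inside[OF w]])
    qed
    then show ?thesis by (simp add: t algebra_simps)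
  qed (use s t in auto)
  have "X w \<in> cball x \<rho>" if w: "w \<in> {t..t + h}" for w
  proof (rule ccontr)
    assume "X w \<notin> cball x \<rho>"
    then have far: "\<rho> \<le> dist x (X w)" by simp
    \<comment> \<open>\<open>S\<close> collects the times at distance at least
      \<open>\<rho>\<close>; by compactness it has a least element, the first exit time.\<close>
    define S where "S = {t..t + h} \<inter> (\<lambda>s. dist x (X s)) -` {\<rho>..}"
    have "compact S"
    proof -
      have "closed S" unfolding S_def
        by (rule continuous_closed_preimage) (auto intro!: continuous_intros cont)
      moreover have "bounded S" unfolding S_def by (rule bounded_subset[of "{t..t + h}"]) auto
      ultimately show ?thesis by (simp add: compact_eq_bounded_closed)
    qed
    moreover have "S \<noteq> {}" using w far by (auto simp: S_def)
    ultimately obtain s where s: "s \<in> S" "\<And>s'. s' \<in> S \<Longrightarrow> s \<le> s'"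
      using compact_attains_inf by metis
    have "norm (X s - x) \<le> M * (s - t)"
    proof (rule *)
      show "s \<in> {t..t + h}" using s(1) by (simp add: S_def)
      fix v assume v: "t < v" "v < s"
      then have "v \<notin> S" using s(2) by force
      then show "X v \<in> cball x \<rho>" using v s(1) by (simp add: S_def)
    qed
    also have "\<dots> \<le> M * h"
      using s(1) M0 by (auto simp: S_def intro!: mult_left_mono)
    finally show False
      using s(1) M by (simp add: S_def dist_norm norm_minus_commute)
  qed
  then show ?thesis using *[of "t + h"] h by auto
qed

section \<open>Gradient and linearization of the first integral\<close>

lemma has_derivative_grad:
  assumes "I differentiable at x"
  shows "(I has_derivative (\<lambda>v. grad I x \<bullet> v)) (at x)"
proof -
  let ?D = "frechet_derivative I (at x)"
  have lin: "linear ?D" by (rule linear_frechet_derivative[OF assms])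
  have "?D v = grad I x \<bullet> v" for v
  proof -
    have "?D v = ?D (\<Sum>j\<in>UNIV. (v $ j) *\<^sub>R axis j 1)"
      by (simp add: basis_expansion flip: scalar_mult_eq_scaleR)
    also have "\<dots> = (\<Sum>j\<in>UNIV. (v $ j) * ?D (axis j 1))"
      using lin by (simp add: linear_sum linear_scale)
    also have "\<dots> = grad I x \<bullet> v"
      by (simp add: grad_def inner_vec_def mult.commute)
    finally show ?thesis .
  qed
  then have "?D = (\<lambda>v. grad I x \<bullet> v)" by blast
  then show ?thesis using assms frechet_derivative_works by metis
qed

text \<open>Mean value inequality for z \<mapsto> I z - a . z, whose gradient \<open>g z - a\<close>
  is at most \<open>\<epsilon>\<close> on the convex set.\<close>

lemma linearization_error:
  fixes I :: "'a::euclidean_space \<Rightarrow> real"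
  assumes S: "convex S" and uv: "u \<in> S" "v \<in> S"
    and deriv: "\<And>z. z \<in> S \<Longrightarrow> (I has_derivative (\<lambda>w. g z \<bullet> w)) (at z)"
    and close: "\<And>z. z \<in> S \<Longrightarrow> norm (g z - a) \<le> \<epsilon>"
  shows "\<bar>I u - I v - a \<bullet> (u - v)\<bar> \<le> \<epsilon> * norm (u - v)"
proof -
  have "norm ((I u - a \<bullet> u) - (I v - a \<bullet> v)) \<le> \<epsilon> * norm (u - v)"
  proof (rule differentiable_bound[OF S _ _ uv, where f' = "\<lambda>z w. (g z - a) \<bullet> w"])
    fix z assume z: "z \<in> S"
    have "((\<lambda>z. I z - a \<bullet> z) has_derivative (\<lambda>w. g z \<bullet> w - a \<bullet> w)) (at z)"
      by (rule has_derivative_diff[OF deriv[OF z]]) (intro derivative_intros)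
    then show "((\<lambda>z. I z - a \<bullet> z) has_derivative (\<lambda>w. (g z - a) \<bullet> w)) (at z within S)"
      by (simp add: inner_diff_left has_derivative_at_withinI)
    show "onorm (\<lambda>w. (g z - a) \<bullet> w) \<le> \<epsilon>"
    proof (rule onorm_le)
      fix w
      have "norm ((g z - a) \<bullet> w) \<le> norm (g z - a) * norm w"
        by (simp add: Cauchy_Schwarz_ineq2)
      also have "\<dots> \<le> \<epsilon> * norm w"
        by (rule mult_right_mono[OF close[OF z]]) simp
      finally show "norm ((g z - a) \<bullet> w) \<le> \<epsilon> * norm w" .
    qed
  qed
  then show ?thesis by (simp add: inner_diff_right algebra_simps)
qed

text \<open>The radius is proportional to \<open>norm (g x)\<close> so that the relative error stays small near the zeros of \<open>g\<close>.\<close>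

lemma locally_lipschitz_relative_closeness:
  fixes g :: "'a::euclidean_space \<Rightarrow> 'b::euclidean_space"
  assumes lip: "local_lipschitz UNIV UNIV (\<lambda>_::real. g)" and B: "compact B" and \<epsilon>: "0 < \<epsilon>"
  obtains \<delta> where "0 < \<delta>"
    "\<And>x z. \<lbrakk>x \<in> B; z \<in> cball x (\<delta> * norm (g x))\<rbrakk> \<Longrightarrow> norm (g z - g x) \<le> \<epsilon> * norm (g x)"
proof -
  \<comment> \<open>The unit neighbourhood of \<open>B\<close> is compact, which gives one Lipschitz
    constant valid near every point of \<open>B\<close>.\<close>
  define K where "K = (\<Union>x\<in>B. cball x 1)"
  have "compact K" unfolding K_def by (rule compact_minkowski_sum_cball[OF B])
  moreover have "local_lipschitz {0::real} K (\<lambda>_. g)"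
    by (rule local_lipschitz_subset[OF lip]) auto
  ultimately obtain l where l: "l-lipschitz_on K g"
    using local_lipschitz_compact_implies_lipschitz[of "{0::real}" K "\<lambda>_. g"] by auto
  have "continuous_on B g"
    by (rule continuous_on_subset[OF local_lipschitz_continuous_on[OF lip]]) auto
  then have "bounded (g ` B)"
    by (intro compact_imp_bounded compact_continuous_image B)
  then obtain M where M: "0 < M" "\<And>x. x \<in> B \<Longrightarrow> norm (g x) \<le> M"
    by (auto simp: bounded_pos)
  have l0: "0 \<le> l" using l by (rule lipschitz_on_nonneg)
  \<comment> \<open>The first bound keeps the ball of radius \<open>\<delta> * norm (g x)\<close>
    inside \<open>K\<close>; the second makes \<open>l * \<delta> \<le> \<epsilon>\<close>, with
    \<open>l + 1\<close> because \<open>l\<close> may vanish.\<close>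
  define \<delta> where "\<delta> = min (1 / M) (\<epsilon> / (l + 1))"
  show ?thesis
  proof
    show \<delta>: "0 < \<delta>" using M(1) \<epsilon> l0 by (simp add: \<delta>_def)
    fix x z assume x: "x \<in> B" and z: "z \<in> cball x (\<delta> * norm (g x))"
    have "\<delta> * norm (g x) \<le> 1 / M * M"
      by (rule mult_mono) (use M x in \<open>auto simp: \<delta>_def\<close>)
    then have "z \<in> K" "x \<in> K"
      using x z M(1) by (force simp: K_def)+
    then have "norm (g z - g x) \<le> l * norm (z - x)"
      using lipschitz_onD[OF l] by (simp add: dist_norm)
    also have "\<dots> \<le> l * (\<delta> * norm (g x))"
      using z l0 by (intro mult_left_mono) (auto simp: dist_norm norm_minus_commute)
    also have "\<dots> \<le> l * (\<epsilon> / (l + 1)) * norm (g x)"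
      unfolding mult.assoc[symmetric] using l0 by (intro mult_right_mono mult_left_mono) (auto simp: \<delta>_def)
    also have "\<dots> \<le> \<epsilon> * norm (g x)"
      using l0 \<epsilon> by (intro mult_right_mono) (auto simp: field_simps)
    finally show "norm (g z - g x) \<le> \<epsilon> * norm (g x)" .
  qed
qed

section \<open>The balls and the approximation estimates on them\<close>

lemma iball_eq_cball: "iball i R x = cball x (norm (i x) / R)"
  by (auto simp: iball_def dist_norm norm_minus_commute)

lemma iball_antimono: "0 < R \<Longrightarrow> R \<le> R' \<Longrightarrow> iball i R' x \<subseteq> iball i R x"
  unfolding iball_eq_cball by (intro subset_cball divide_left_mono) auto

lemma approximation_lipschitz:
  assumes "approximation i R L H B \<phi> \<phi>t" "0 < R" "R \<le> R'" "x \<in> B" "h \<in> {0..<H}"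
    and "u \<in> iball i R' x" "v \<in> iball i R' x"
  shows "norm (\<phi>t x u h - \<phi>t x v h) \<le> L * norm (u - v)"
proof -
  have "x \<in> iball i R x" using assms(2) by (simp add: iball_def)
  then show ?thesis
    using assms iball_antimono[OF assms(2,3), of i x] unfolding approximation_def by blast
qed

text \<open>Comparing through \<open>\<phi>t x x h\<close>, each half costs one tenth: moving
  \<open>u\<close> to \<open>x\<close> by \<open>10 * L \<le> R'\<close>, and replacing
  \<open>h\<close> by 0 by \<open>h \<le> 1 / (10 * L)\<close>.\<close>

lemma approximation_error:
  assumes A: "approximation i R L H B \<phi> \<phi>t" and R: "0 < R" "R \<le> R'" and L: "0 < L" "10 * L \<le> R'"
    and x: "x \<in> B" and h: "h \<in> {0..<H}" "h \<le> 1 / (10 * L)" and u: "u \<in> iball i R' x"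
  shows "norm (\<phi>t x u h - \<phi> x) \<le> norm (i x) / 5"
proof -
  have R': "0 < R'" using R by simp
  have x': "x \<in> iball i R x" "x \<in> iball i R' x" using R R' by (simp_all add: iball_def)
  have "norm (\<phi>t x u h - \<phi>t x x h) \<le> L * norm (u - x)"
    by (rule approximation_lipschitz[OF A R x h(1) u x'(2)])
  also have "\<dots> \<le> L * (norm (i x) / R')"
    using u L(1) by (intro mult_left_mono) (auto simp: iball_def)
  also have "\<dots> = L / R' * norm (i x)" by simp
  also have "\<dots> \<le> 1 / 10 * norm (i x)"
    using L R' by (intro mult_right_mono) (auto simp: field_simps)
  finally have 1: "norm (\<phi>t x u h - \<phi>t x x h) \<le> norm (i x) / 10" by simp
  have "\<phi>t x x 0 = \<phi> x" "norm (\<phi>t x x h - \<phi>t x x 0) \<le> L * h * norm (i x)"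
    using A x x' h(1) unfolding approximation_def by blast+
  moreover have "L * h * norm (i x) \<le> 1 / 10 * norm (i x)"
    using h(2) L(1) by (intro mult_right_mono) (auto simp: field_simps)
  ultimately have 2: "norm (\<phi>t x x h - \<phi> x) \<le> norm (i x) / 10" by simp
  show ?thesis
    using 1 2 norm_triangle_ineq[of "\<phi>t x u h - \<phi>t x x h" "\<phi>t x x h - \<phi> x"] by simp
qed

section \<open>Transfer of the order from the unprojected to the projected method\<close>

theorem theorem6:
  fixes f i :: "real^'n \<Rightarrow> real^'n"
    and I :: "real^'n \<Rightarrow> real"
    and B :: "(real^'n) set"
    and C\<^sub>1 C\<^sub>2 R L H R' H' :: real
    and ft it :: "real^'n \<Rightarrow> real^'n \<Rightarrow> real \<Rightarrow> real^'n"
    and p k :: nat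
  assumes "local_lipschitz UNIV UNIV (\<lambda>_::real. f)"
    and "first_integral f I"
    and "morse_function I"
    and "i = grad I"
    and "local_lipschitz UNIV UNIV (\<lambda>_::real. i)"
    and "\<forall>S. bounded S \<longrightarrow> (\<exists>C. \<forall>x\<in>S. norm (f x) \<le> C * norm (i x))"
    and "compact B"
    and "\<forall>x\<in>B. norm (f x) \<le> C\<^sub>1 * norm (i x)"
    and "C\<^sub>2 = C\<^sub>1 + 1 / 5"
    and "R > 0" "L > 0" "H > 0"
    and "approximation i R L H B f ft"
    and "approximation i R L H B i it"
    and "R' = max R (10 * L)"
    and "H' = Min {H, 1 / (10 * L), 1 / (6 * C\<^sub>2 * R'), 1 / ((36 * C\<^sub>2 + 6) * L)}"
    and "\<forall>x\<in>B. \<forall>u\<in>iball i (5 * R') x. \<forall>v\<in>iball i (5 * R') x.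
           norm (f u - f v) \<le> L * norm (u - v)"
    and "C_k k f \<Longrightarrow> has_order f B H' (implicit_step i (6 * R') ft) p"
  shows "C_k k f \<Longrightarrow> has_order f B H' (projection_step I i R' (11 / 5 * C\<^sub>2) ft it) p"
proof -
  assume "C_k k f"
  then have order: "has_order f B H' (implicit_step i (6 * R') ft) p" by (rule assms(18))
  note first_int = assms(2) and i = assms(4) and f_le = assms(8)[rule_format] and C2 = assms(9)
    and R = assms(10) and L = assms(11) and ft = assms(13) and it = assms(14)
    and R' = assms(15) and f_lip = assms(17)[rule_format]
  obtain C\<^sub>3 H\<^sub>3 where C3: "0 < C\<^sub>3" and H3: "0 < H\<^sub>3" "H\<^sub>3 < H'"
    and unique_y: "\<And>h x. \<lbrakk>h \<in> {0..H\<^sub>3}; x \<in> B\<rbrakk> \<Longrightarrow> \<exists>!y. implicit_step i (6 * R') ft h x y"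
    and error_y: "\<And>h x y X t. \<lbrakk>h \<in> {0..H\<^sub>3}; x \<in> B; implicit_step i (6 * R') ft h x y; 0 \<le> t;
      ode_solution_on f {t..t + h} X; X t = x\<rbrakk> \<Longrightarrow> norm (y - X (t + h)) \<le> C\<^sub>3 * h ^ (p + 1)"
    using order unfolding has_order_def by metis
  have R'_pos: "0 < R'" "R \<le> R'" "10 * L \<le> R'" using R L R' by auto
  have H': "H' \<le> H" "H' \<le> 1 / (10 * L)" "H' \<le> 1 / (6 * C\<^sub>2 * R')" "H' \<le> 1 / ((36 * C\<^sub>2 + 6) * L)"
    unfolding assms(16) by (auto intro: Min_le)
  \<comment> \<open>The sign of \<open>C\<^sub>2\<close> follows from 0 < \<open>H\<^sub>3\<close> <
    \<open>H'\<close> \<le> \<open>1 / (6 * C\<^sub>2 * R')\<close>.\<close>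
  have C2_pos: "0 < C\<^sub>2"
  proof -
    have "0 < 1 / (6 * C\<^sub>2 * R')" using H3 H'(3) by linarith
    then show ?thesis using R'_pos(1) by (simp add: zero_less_mult_iff)
  qed
  obtain \<delta> where \<delta>: "0 < \<delta>"
    "\<And>x z. \<lbrakk>x \<in> B; z \<in> cball x (\<delta> * norm (i x))\<rbrakk> \<Longrightarrow> norm (i z - i x) \<le> 1 / 10 * norm (i x)"
    using locally_lipschitz_relative_closeness[OF assms(5,7), of "1 / 10"] by auto
  have I_diff: "I differentiable (at x)" for x
  proof -
    have "C_k (Suc 0) I" using assms(3) unfolding morse_function_def smooth_def by blast
    then show ?thesis by (simp add: differentiable_on_def)
  qed
  \<comment> \<open>The second bound puts the inner ball, of radius
    \<open>4 * h * C\<^sub>2 * norm (i x)\<close>, into the ball where \<open>i\<close> deviates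
    from \<open>i x\<close> by at most a tenth.\<close>
  define H\<^sub>5 where "H\<^sub>5 = min H\<^sub>3 (\<delta> / (4 * C\<^sub>2))"
  have step: "(\<exists>!x'. projection_step I i R' (11 / 5 * C\<^sub>2) ft it h x x') \<and>
      (\<forall>x' X t. projection_step I i R' (11 / 5 * C\<^sub>2) ft it h x x' \<and> 0 \<le> t \<and>
         ode_solution_on f {t..t + h} X \<and> X t = x \<longrightarrow>
         norm (x' - X (t + h)) \<le> 6 * C\<^sub>3 * h ^ (p + 1))"
    if h: "h \<in> {0..H\<^sub>5}" and x: "x \<in> B" for h x
  proof -
    have h0: "0 \<le> h" "h \<in> {0..H\<^sub>3}" and h_less: "h < H'" and h_\<delta>: "h * (4 * C\<^sub>2) \<le> \<delta>"
      using h H3 C2_pos by (auto simp: H\<^sub>5_def field_simps)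
    have h_H: "h \<in> {0..<H}" "h \<le> 1 / (10 * L)"
      using h0 h_less H' by auto
    have h_R': "6 * h * C\<^sub>2 * R' \<le> 1"
    proof -
      have "h \<le> 1 / (6 * C\<^sub>2 * R')" using h_less H'(3) by linarith
      then show ?thesis using C2_pos R'_pos(1) by (simp add: field_simps)
    qed
    \<comment> \<open>The last term of \<open>H'\<close> yields h L (1 + 6 \<open>C\<^sub>2\<close>)
      \<le> 1/6, and 11/5 < 6.\<close>
    have h_L: "h * L * (1 + 11 / 5 * C\<^sub>2) \<le> 1 / 6"
    proof -
      have "h \<le> 1 / ((36 * C\<^sub>2 + 6) * L)" using h_less H'(4) by linarith
      then have "h * ((36 * C\<^sub>2 + 6) * L) \<le> 1"
        using C2_pos L by (simp add: pos_le_divide_eq)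
      moreover have "0 \<le> h * L * C\<^sub>2" using h0 L C2_pos by simp
      ultimately show ?thesis by (simp add: algebra_simps)
    qed
    have ball_\<delta>: "cball x (4 * h * C\<^sub>2 * norm (i x)) \<subseteq> cball x (\<delta> * norm (i x))"
      using mult_right_mono[OF h_\<delta>, of "norm (i x)"] by (auto simp: mult_ac)
    interpret projected_step x "i x" "\<lambda>u. ft x u h" "\<lambda>u. it x u h" I "norm (i x) / R'" L C\<^sub>2 h
    proof
      fix u v assume uv: "u \<in> cball x (norm (i x) / R')" "v \<in> cball x (norm (i x) / R')"
      show "norm (ft x u h - ft x v h) \<le> L * norm (u - v)"
        using approximation_lipschitz[OF ft R R'_pos(2) x h_H(1)] uv by (simp add: iball_eq_cball)
      show "norm (it x u h - it x v h) \<le> L * norm (u - v)"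
        using approximation_lipschitz[OF it R R'_pos(2) x h_H(1)] uv by (simp add: iball_eq_cball)
    next
      fix u assume u: "u \<in> cball x (norm (i x) / R')"
      have "norm (ft x u h - f x) \<le> norm (i x) / 5"
        using approximation_error[OF ft R R'_pos(2) L R'_pos(3) x h_H] u by (simp add: iball_eq_cball)
      \<comment> \<open>The summand 1/5 in \<open>C\<^sub>2\<close> pays for the approximation error
        of \<open>ft\<close>.\<close>
      then show "norm (ft x u h) \<le> C\<^sub>2 * norm (i x)"
        using f_le[OF x] norm_triangle_ineq2[of "ft x u h" "f x"] by (simp add: C2 distrib_right)
      show "norm (it x u h - i x) \<le> norm (i x) / 5"
        using approximation_error[OF it R R'_pos(2) L R'_pos(3) x h_H] u by (simp add: iball_eq_cball)
    next
      fix u v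
      assume uv: "u \<in> cball x (4 * h * C\<^sub>2 * norm (i x))" "v \<in> cball x (4 * h * C\<^sub>2 * norm (i x))"
      show "\<bar>I u - I v - i x \<bullet> (u - v)\<bar> \<le> norm (i x) / 10 * norm (u - v)"
      proof (rule linearization_error[OF convex_cball uv])
        show "(I has_derivative (\<lambda>w. i z \<bullet> w)) (at z)" for z
          unfolding i by (rule has_derivative_grad[OF I_diff])
        show "norm (i z - i x) \<le> norm (i x) / 10" if "z \<in> cball x (4 * h * C\<^sub>2 * norm (i x))" for z
          using \<delta>(2)[OF x, of z] that ball_\<delta> by auto
      qed
    next
      show "6 * h * C\<^sub>2 * norm (i x) \<le> norm (i x) / R'"
        using mult_right_mono[OF h_R', of "norm (i x)"] R'_pos(1) by (simp add: field_simps)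
    qed (use h0 C2_pos L h_L in auto)
    let ?D = "cball x (norm (i x) / R')"
    have projection_iff: "projection_step I i R' (11 / 5 * C\<^sub>2) ft it h x u \<longleftrightarrow>
        u \<in> ?D \<and> (\<exists>\<mu>. \<bar>\<mu>\<bar> \<le> 11 / 5 * C\<^sub>2 * h \<and> step_map \<mu> u = u \<and> I u = I x)" for u
      unfolding projection_step_def iball_eq_cball step_map_def by metis
    have unique: "u = v"
      if u: "projection_step I i R' (11 / 5 * C\<^sub>2) ft it h x u"
        and v: "projection_step I i R' (11 / 5 * C\<^sub>2) ft it h x v" for u v
    \<comment> \<open>At a critical point the ball is just {x}, so \<open>x'\<close> is unique
      although the multiplier is not.\<close>
    proof (cases "i x = 0")
      case True
      then show ?thesis using u v unfolding projection_iff by simp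
    next
      case False
      have "norm (i x) * norm (u - v) \<le> 4 * \<bar>I u - I v\<bar>"
        using u v unfolding projection_iff by (blast intro: fixpoint_increment)
      also have "I u = I v" using u v unfolding projection_iff by metis
      finally have "norm (i x) * norm (u - v) \<le> 0" by simp
      then show ?thesis using False by (simp add: mult_le_0_iff)
    qed
    have "norm (x' - X (t + h)) \<le> 6 * C\<^sub>3 * h ^ (p + 1)"
      if x': "projection_step I i R' (11 / 5 * C\<^sub>2) ft it h x x'" and t: "0 \<le> t"
        and X: "ode_solution_on f {t..t + h} X" "X t = x" for x' X t
    proof -
      let ?z = "X (t + h)"
      obtain y where y: "implicit_step i (6 * R') ft h x y"
        using unique_y[OF h0(2) x] by blast
      have y_error: "norm (y - ?z) \<le> C\<^sub>3 * h ^ (p + 1)"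
        by (rule error_y[OF h0(2) x y t X])
      \<comment> \<open>The smaller ball of the unprojected method lies in the present one, so
        \<open>y\<close> is the fixed point for multiplier 0.\<close>
      have "y \<in> iball i R' x"
        using y iball_antimono[of R' "6 * R'" i x] R'_pos(1) by (auto simp: implicit_step_def)
      then have y_mem: "y \<in> ?D" "step_map 0 y = y"
        using y by (simp_all add: iball_eq_cball implicit_step_def step_map_def)
      have "norm (x' - ?z) \<le> 6 * norm (y - ?z)"
      \<comment> \<open>At a critical point both steps return \<open>x\<close>, so their errors
        coincide whatever the exact solution does.\<close>
      proof (cases "i x = 0")
        case True
        then have "x' = y" using x' y_mem unfolding projection_iff by simp
        then show ?thesis by simp
      next
        case False
        then have n: "0 < norm (i x)" by simp
        \<comment> \<open>On the ball of radius \<open>norm (i x) / (5 * R')\<close> the Lipschitz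
          bound changes \<open>f\<close> by at most \<open>norm (i x) / 5\<close>, so
          \<open>C\<^sub>2 * norm (i x)\<close> bounds the speed as well.\<close>
        have "norm (?z - x) \<le> C\<^sub>2 * norm (i x) * h"
        proof (rule solution_stays_close[OF X(1) h0(1) X(2)])
          fix w assume w: "w \<in> cball x (norm (i x) / (5 * R'))"
          have "norm (f w - f x) \<le> L * norm (w - x)"
            using w R'_pos(1) by (intro f_lip[OF x]) (simp_all add: iball_eq_cball)
          also have "\<dots> \<le> L * (norm (i x) / (5 * R'))"
            using w L by (intro mult_left_mono) (auto simp: dist_norm norm_minus_commute)
          also have "\<dots> \<le> norm (i x) / 5"
          proof -
            have "L * norm (i x) \<le> R' * norm (i x)"
              using R'_pos(3) L by (intro mult_right_mono) auto
            then show ?thesis using R'_pos(1) by (simp add: field_simps)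
          qed
          finally show "norm (f w) \<le> C\<^sub>2 * norm (i x)"
            using f_le[OF x] norm_triangle_ineq2[of "f w" "f x"] by (simp add: C2 distrib_right)
        next
          \<comment> \<open>The factor 5 against the 6 in \<open>H'\<close> gives the strict
            inequality that excludes an exit; it also uses \<open>i x \<noteq> 0\<close>.\<close>
          have "5 * (h * C\<^sub>2 * R') < 1" using h_R' by linarith
          then have "5 * (h * C\<^sub>2 * R') * norm (i x) < 1 * norm (i x)"
            using n by (rule mult_strict_right_mono)
          then show "C\<^sub>2 * norm (i x) * h < norm (i x) / (5 * R')"
            using R'_pos(1) by (simp add: field_simps)
        qed (use C2_pos in simp)
        moreover have "0 \<le> h * C\<^sub>2 * norm (i x)" using h0(1) C2_pos by simp
        ultimately have z: "?z \<in> cball x (4 * h * C\<^sub>2 * norm (i x))"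
          by (simp add: dist_norm norm_minus_commute mult_ac)
        have "(\<lambda>s. I (X s)) constant_on {t..t + h}"
          using first_int X(1) unfolding first_integral_def by (simp add: is_interval_cc)
        then have "I ?z = I x"
          using h0(1) X(2) unfolding constant_on_def by fastforce
        then show ?thesis
          using x' unfolding projection_iff by (metis projection_error[OF False _ _ _ y_mem z])
      qed
      then show ?thesis using y_error by simp
    qed
    then show ?thesis
      using ex_projection unique unfolding projection_iff by blast
  qed
  show "has_order f B H' (projection_step I i R' (11 / 5 * C\<^sub>2) ft it) p"
    unfolding has_order_def
  proof (intro exI conjI ballI)
    show "0 < 6 * C\<^sub>3" "0 < H\<^sub>5" "H\<^sub>5 < H'"
      using C3 H3 \<delta>(1) C2_pos by (auto simp: H\<^sub>5_def)
  qed (use step in blast)+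
qed

end
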